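(* Let $p(x)=\prod_{j=0}^n(x-x_j)\in\mathbb{C}[x]$ be a monic complex univariate polynomial of degree $n+1$. If all critical values of $p$ lie in the unit disk $\{|t|\le 1\}$, then the diameter of the set of its roots is no greater than $4e$, i.e. $|x_j-x_k|\le 4e$ for all $j,k=0,\dots,n$.
   Context: A critical value of $p$ is a value $p(a)$ with $a\in\mathbb{C}$, $p'(a)=0$. Here $e$ is the base of natural logarithms. *)

theory Defs
  imports "HOL-Analysis.Analysis" "HOL-Computational_Algebra.Polynomial"
begin

definition critical_values :: "complex poly \<Rightarrow> complex set"
  where "critical_values p = {poly p a | a. poly (pderiv p) a = 0}"

end

theory Submission
  imports Defs "HOL-Complex_Analysis.Conformal_Mappings"
    "HOL-Computational_Algebra.Fundamental_Theorem_Algebra"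
begin

text \<open>
  As the critical values of \<open>p\<close> lie in the closed unit disk, \<open>p\<close> is a covering map over
  \<open>{w. 1 < \<bar>w\<bar>}\<close>. Lifting the radial contraction of this set to \<open>{w. 2 \<le> \<bar>w\<bar>}\<close> retracts the
  plane onto the lemniscate \<open>{z. \<bar>p z\<bar> \<le> 2}\<close>, which is therefore connected. Its orthogonal projection to the
  line through two roots at distance \<open>D\<close> contains the segment between them. Projecting the roots
  as well only decreases \<open>\<bar>p\<bar>\<close>, so there is a monic real polynomial of degree \<open>d\<close> bounded by \<open>2\<close>
  on \<open>[0, D]\<close>. Its \<open>d\<close>-th finite difference with step \<open>D / d\<close> equals \<open>d! (D / d)^d\<close> and is at
  most \<open>2^d * 2\<close>, whence \<open>D^d \<le> 2 (2 e)^d \<le> (4 e)^d\<close>.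
\<close>

section \<open>Covering maps given by polynomials\<close>

lemma card_roots_rsquarefree:
  fixes p :: "complex poly"
  assumes "rsquarefree p"
  shows "card {z. poly p z = 0} = degree p"
proof -
  have "p \<noteq> 0" using assms by (auto simp: rsquarefree_def)
  hence "degree (smult (lead_coeff p) (\<Prod>z|poly p z = 0. [:-z, 1:])) = card {z. poly p z = 0}"
    by (simp add: degree_prod_sum_eq)
  thus ?thesis by (simp add: complex_poly_decompose_rsquarefree[OF assms])
qed

text \<open>Every fibre over \<open>S\<close> has exactly \<open>degree p\<close> points. Disjoint
  balls around the points of one fibre, with \<open>p\<close> injective on each, therefore already
  contain all preimages of nearby values and provide the sheets.\<close>

lemma covering_space_poly:
  fixes p :: "complex poly"
  assumes deg: "degree p > 0" and S: "open S"
    and noncrit: "\<And>z. poly p z \<in> S \<Longrightarrow> poly (pderiv p) z \<noteq> 0"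
  shows "covering_space (poly p -` S) (poly p) S"
proof
  let ?C = "poly p -` S"
  have openC: "open ?C"
    by (intro continuous_open_vimage S) (auto intro!: continuous_intros)
  show "continuous_on ?C (poly p)" by (intro continuous_intros)
  define Z where "Z w = {z. poly p z = w}" for w
  have Z_eq: "Z w = {z. poly (p - [:w:]) z = 0}" for w
    by (auto simp: Z_def)
  have dw: "degree (p - [:w:]) = degree p" for w
    using deg by (metis degree_pCons_0 diff_conv_add_uminus degree_add_eq_left degree_minus)
  have ne: "p - [:w:] \<noteq> 0" for w using dw[of w] deg by auto
  have fin: "finite (Z w)" for w
    unfolding Z_eq using ne by (rule poly_roots_finite)
  have card_le: "card (Z w) \<le> degree p" for w
    unfolding Z_eq using card_poly_roots_bound[OF ne[of w]] dw by simp
  \<comment> \<open>\<open>p - [:w:]\<close> has derivative \<open>pderiv p\<close>, which by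
    \<open>noncrit\<close> vanishes nowhere on the fibre, so all roots are simple.\<close>
  have card_eq: "card (Z w) = degree p" if "w \<in> S" for w
    unfolding Z_eq
    by (subst card_roots_rsquarefree)
       (use that noncrit in \<open>auto simp: dw rsquarefree_roots pderiv_diff pderiv_pCons\<close>)
  show "poly p ` ?C = S"
  proof safe
    fix w assume w: "w \<in> S"
    have "Z w \<noteq> {}" using card_eq[OF w] deg by auto
    then obtain z where "poly p z = w" by (auto simp: Z_def)
    with w show "w \<in> poly p ` ?C" by auto
  qed
  fix w assume w: "w \<in> S"
  have "\<forall>z\<in>Z w. \<exists>r>0. ball z r \<subseteq> ?C \<and> inj_on (poly p) (ball z r) \<and> open (poly p ` ball z r) \<and>
           (\<forall>y\<in>Z w. y \<noteq> z \<longrightarrow> 2 * r \<le> dist z y)"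
  proof
    fix z assume "z \<in> Z w"
    obtain \<delta> where \<delta>: "\<delta> > 0" "\<forall>y\<in>Z w. y \<noteq> z \<longrightarrow> \<delta> \<le> dist z y"
      using finite_set_avoid[OF fin] by blast
    have z: "z \<in> ?C" "poly p z \<in> S" using \<open>z \<in> Z w\<close> w by (auto simp: Z_def)
    have "deriv (poly p) z \<noteq> 0"
      using noncrit[OF z(2)] by (simp add: DERIV_imp_deriv[OF poly_DERIV])
    moreover have "poly p holomorphic_on ?C"
      by (intro holomorphic_intros)
    ultimately obtain r where r: "r > 0" "ball z r \<subseteq> ?C" "inj_on (poly p) (ball z r)"
      using has_complex_derivative_locally_injective[OF _ z(1) openC] by metis
    \<comment> \<open>Halving the separation \<delta> of the fibre makes the balls around its points
      disjoint.\<close>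
    define s where "s = min r (\<delta> / 2)"
    have s: "ball z s \<subseteq> ball z r" by (auto simp: s_def)
    have "inj_on (poly p) (ball z s)" using r(3) s by (rule inj_on_subset)
    moreover from this have "open (poly p ` ball z s)"
      by (intro invariance_of_domain continuous_intros) auto
    ultimately show "\<exists>r>0. ball z r \<subseteq> ?C \<and> inj_on (poly p) (ball z r) \<and>
        open (poly p ` ball z r) \<and> (\<forall>y\<in>Z w. y \<noteq> z \<longrightarrow> 2 * r \<le> dist z y)"
      using r \<delta> s by (intro exI[of _ s]) (fastforce simp: s_def)
  qed
  from bchoice[OF this] obtain r where r: "\<And>z. z \<in> Z w \<Longrightarrow> r z > 0"
    "\<And>z. z \<in> Z w \<Longrightarrow> ball z (r z) \<subseteq> ?C"
    "\<And>z. z \<in> Z w \<Longrightarrow> inj_on (poly p) (ball z (r z))"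
    "\<And>z. z \<in> Z w \<Longrightarrow> open (poly p ` ball z (r z))"
    "\<And>z y. z \<in> Z w \<Longrightarrow> y \<in> Z w \<Longrightarrow> y \<noteq> z \<Longrightarrow> 2 * r z \<le> dist z y"
    by blast
  have disj: "ball z (r z) \<inter> ball y (r y) = {}" if "z \<in> Z w" "y \<in> Z w" "y \<noteq> z" for z y
  proof (rule disjoint_ballI)
    show "r z + r y \<le> dist z y"
      using r(5)[of z y] r(5)[of y z] that by (simp add: dist_commute)
  qed
  \<comment> \<open>The values attained in every ball form the evenly covered neighbourhood
    \<open>T\<close>; \<open>V z\<close> is the sheet around \<open>z\<close>.\<close>
  define T where "T = S \<inter> (\<Inter>z\<in>Z w. poly p ` ball z (r z))"
  define V where "V z = ball z (r z) \<inter> poly p -` T" for z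
  have openT: "open T"
    unfolding T_def using r(4) fin S by (intro open_Int open_INT) auto
  have openV: "open (V z)" for z
    unfolding V_def
    by (intro open_Int open_ball continuous_open_vimage openT) (auto intro!: continuous_intros)
  have "w \<in> T"
    unfolding T_def using w r(1) by (auto simp: Z_def image_iff intro!: bexI)
  moreover have "openin (top_of_set S) T"
    using openT by (auto simp: T_def intro: open_subset)
  moreover have "\<Union>(V ` Z w) = ?C \<inter> poly p -` T"
  proof (intro equalityI subsetI)
    fix y assume y: "y \<in> ?C \<inter> poly p -` T"
    have "\<forall>z\<in>Z w. \<exists>x\<in>ball z (r z). poly p x = poly p y"
      using y by (force simp: T_def)
    \<comment> \<open>One preimage of \<open>poly p y\<close> from each ball gives
      \<open>degree p\<close> distinct ones. They exhaust the fibre, so \<open>y\<close> is among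
      them.\<close>
    then obtain g where g: "\<And>z. z \<in> Z w \<Longrightarrow> g z \<in> ball z (r z)"
        "\<And>z. z \<in> Z w \<Longrightarrow> poly p (g z) = poly p y"
      by metis
    have "inj_on g (Z w)"
      using g(1) disj by (intro inj_onI) (metis IntI empty_iff)
    hence "card (g ` Z w) = degree p" by (simp add: card_image card_eq[OF w])
    moreover have "g ` Z w \<subseteq> Z (poly p y)" using g(2) by (auto simp: Z_def)
    ultimately have "g ` Z w = Z (poly p y)"
      using fin card_le by (intro card_seteq) auto
    hence "y \<in> g ` Z w" by (auto simp: Z_def)
    thus "y \<in> \<Union>(V ` Z w)" using g y by (auto simp: V_def)
  qed (auto simp: V_def T_def)
  moreover have "\<forall>u\<in>V ` Z w. openin (top_of_set ?C) u"
    using openV r(2) by (auto simp: V_def intro!: open_subset)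
  moreover have "pairwise disjnt (V ` Z w)"
    using disj by (auto simp: pairwise_def disjnt_def V_def)
  moreover have "\<exists>q. homeomorphism (V z) T (poly p) q" if z: "z \<in> Z w" for z
  proof -
    have "inj_on (poly p) (V z)"
      using r(3)[OF z] by (rule inj_on_subset) (auto simp: V_def)
    moreover have "continuous_on (V z) (poly p)" by (intro continuous_intros)
    ultimately obtain q where "homeomorphism (V z) (poly p ` V z) (poly p) q"
      using invariance_of_domain_homeomorphism[OF openV[of z], of "poly p"] by auto
    moreover have "T \<subseteq> poly p ` ball z (r z)" using z by (auto simp: T_def)
    hence "poly p ` V z = T" unfolding V_def by blast
    ultimately show ?thesis by auto
  qed
  ultimately show "\<exists>T. w \<in> T \<and> openin (top_of_set S) T \<and>
      (\<exists>v. \<Union>v = ?C \<inter> poly p -` T \<and> (\<forall>u\<in>v. openin (top_of_set ?C) u) \<and>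
           pairwise disjnt v \<and> (\<forall>u\<in>v. \<exists>q. homeomorphism u T (poly p) q))"
    by (intro exI[of _ T] conjI exI[of _ "V ` Z w"]) auto
qed

section \<open>Connectedness of lemniscates\<close>

lemma connected_lemniscate:
  fixes p :: "complex poly"
  assumes deg: "degree p > 0" and crit: "critical_values p \<subseteq> cball 0 \<rho>"
    and r: "0 \<le> \<rho>" "\<rho> < r"
  shows "connected {z. cmod (poly p z) \<le> r}"
proof -
  define S where "S = {w::complex. \<rho> < cmod w}"
  define U where "U = {z. r \<le> cmod (poly p z)}"
  have "open S" unfolding S_def by (intro open_Collect_less continuous_intros)
  hence cov: "covering_space (poly p -` S) (poly p) S"
    using deg crit by (intro covering_space_poly) (force simp: S_def critical_values_def)+
  \<comment> \<open>For fixed \<open>z\<close>, this moves \<open>poly p z\<close> along its ray to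
    the circle of radius \<open>r\<close>. The modulus stays at least \<open>r\<close>, hence above
    \<rho>, so the homotopy can be lifted.\<close>
  define h where "h = (\<lambda>(t, z). poly p z * of_real ((1 - t) + t * r / cmod (poly p z)))"
  have norm_h: "cmod (h (t, z)) = (1 - t) * cmod (poly p z) + t * r" if "t \<in> {0..1}" "z \<in> U" for t z
  proof -
    have "cmod (poly p z) > 0" using that r by (auto simp: U_def)
    moreover from this have "(1 - t) + t * r / cmod (poly p z) \<ge> 0" using that r by auto
    ultimately show ?thesis
      by (simp add: h_def norm_mult field_simps del: of_real_add of_real_diff of_real_divide of_real_mult)
  qed
  have conth: "continuous_on ({0..1} \<times> U) h"
    unfolding h_def case_prod_unfold using r
    by (intro continuous_intros) (auto simp: U_def)
  have him: "h \<in> {0..1} \<times> U \<rightarrow> S"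
  proof safe
    fix t z assume tz: "t \<in> {0..1::real}" "z \<in> U"
    have "\<rho> < r" by fact
    also have "r = (1 - t) * r + t * r" by algebra
    also have "\<dots> \<le> (1 - t) * cmod (poly p z) + t * r"
      using tz by (intro add_mono mult_left_mono) (auto simp: U_def)
    finally show "h (t, z) \<in> S" using norm_h[OF tz] by (simp add: S_def)
  qed
  have "(\<lambda>z. z) \<in> U \<rightarrow> poly p -` S" using r by (auto simp: U_def S_def)
  moreover have "h (0, z) = poly p z" for z by (simp add: h_def)
  ultimately obtain k where k: "continuous_on ({0..1} \<times> U) k"
      "\<And>z. z \<in> U \<Longrightarrow> k (0, z) = z"
      "\<And>y. y \<in> {0..1} \<times> U \<Longrightarrow> h y = poly p (k y)"
    by (rule_tac covering_space_lift_homotopy[OF cov conth him _ continuous_on_id]) blast+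
  have k1: "cmod (poly p (k (1, z))) = r" if "z \<in> U" for z
    using norm_h[of 1 z] k(3)[of "(1, z)"] that by simp
  \<comment> \<open>On the level curve \<open>h\<close> does not depend on \<open>t\<close>. The
    lifted path stays in a finite fibre and is constant by connectedness. Hence the two pieces of
    \<open>f\<close> agree where they meet.\<close>
  have fix1: "k (1, z) = z" if z: "cmod (poly p z) = r" for z
  proof -
    have zU: "z \<in> U" using z by (simp add: U_def)
    have "poly p (k (t, z)) = poly p z" if "t \<in> {0..1}" for t
      using k(3)[of "(t, z)"] that zU z r by (auto simp: h_def)
    hence "(\<lambda>t. k (t, z)) ` {0..1} \<subseteq> {y. poly (p - [:poly p z:]) y = 0}" by auto
    moreover have "p - [:poly p z:] \<noteq> 0" using deg by (metis degree_pCons_0 eq_iff_diff_eq_0 less_irrefl)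
    ultimately have "finite ((\<lambda>t. k (t, z)) ` {0..1})"
      using poly_roots_finite finite_subset by blast
    moreover have "continuous_on {0..1} (\<lambda>t. k (t, z))"
      using zU by (intro continuous_on_compose2[OF k(1)] continuous_intros) auto
    ultimately have "(\<lambda>t. k (t, z)) constant_on {0..1}"
      by (intro continuous_finite_range_constant) auto
    hence "k (1, z) = k (0, z)" by (auto simp: constant_on_def)
    thus ?thesis using k(2)[OF zU] by simp
  qed
  define L where "L = {z. cmod (poly p z) \<le> r}"
  define f where "f z = (if cmod (poly p z) \<le> r then z else k (1, z))" for z
  have "closed L" "closed U"
    unfolding L_def U_def by (intro closed_Collect_le continuous_intros)+
  moreover have "continuous_on U (\<lambda>z. k (1, z))"
    by (intro continuous_on_compose2[OF k(1)] continuous_intros) auto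
  ultimately have "continuous_on (L \<union> U) f"
    unfolding f_def using fix1
    by (intro continuous_on_cases continuous_intros) (auto simp: L_def U_def)
  moreover have "L \<union> U = UNIV" by (auto simp: L_def U_def)
  ultimately have "connected (f ` UNIV)" by (metis connected_UNIV connected_continuous_image)
  moreover have "f ` UNIV = L"
    using k1 by (force simp: f_def L_def U_def image_iff)
  ultimately show ?thesis by (simp add: L_def)
qed

section \<open>Finite differences and monic polynomials on an interval\<close>

text \<open>Vanishing coefficients, instead of a degree bound, also cover \<open>d = 0\<close>,
  where \<open>d - 1\<close> is \<open>0\<close> and \<open>r\<close> must be the zero
  polynomial.\<close>

lemma forward_difference_poly:
  fixes q :: "'a::comm_ring_1 poly" and h :: 'a
  assumes "degree q \<le> d"
  shows "\<exists>r. (\<forall>n\<ge>d. coeff r n = 0) \<and> coeff r (d - 1) = of_nat d * h * coeff q d \<and>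
           (\<forall>t. poly r t = poly q (t + h) - poly q t)"
  using assms
proof (induction d arbitrary: q)
  case 0
  then obtain c where "q = [:c:]" by (auto elim: degree_eq_zeroE)
  thus ?case by (intro exI[of _ 0]) auto
next
  case (Suc d)
  obtain c s where q: "q = pCons c s" by (cases q)
  have s: "degree s \<le> d" using Suc.prems by (auto simp: q split: if_splits)
  then obtain r where r: "\<forall>n\<ge>d. coeff r n = 0" "coeff r (d - 1) = of_nat d * h * coeff s d"
      "\<forall>t. poly r t = poly s (t + h) - poly s t"
    using Suc.IH by blast
  \<comment> \<open>For \<open>q = c + t * s\<close>, the difference of \<open>q\<close> is
    \<open>t * r + h * s + h * r\<close>, with \<open>r\<close> the difference of
    \<open>s\<close>.\<close>
  have "coeff (pCons 0 r + smult h s + smult h r) n = 0" if "n \<ge> Suc d" for n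
    using r(1) s that by (auto simp: coeff_pCons coeff_eq_0 split: nat.splits)
  moreover have "coeff (pCons 0 r + smult h s + smult h r) d = of_nat (Suc d) * h * coeff s d"
    using r by (cases d) (auto simp: algebra_simps)
  moreover have "poly s (t + h) = poly r t + poly s t" for t
    using r(3) by simp
  ultimately show ?case
    by (intro exI[of _ "pCons 0 r + smult h s + smult h r"]) (auto simp: q algebra_simps)
qed

text \<open>Each difference uses up one node and at most doubles the bound; after \<open>d\<close>
  of them only the constant \<open>coeff q d * fact d * h ^ d\<close> is left.\<close>

lemma lead_coeff_bound_equidistant:
  fixes q :: "real poly"
  assumes "degree q \<le> d" "h \<ge> 0" "\<And>i. i \<le> d \<Longrightarrow> \<bar>poly q (a + of_nat i * h)\<bar> \<le> M"
  shows "\<bar>coeff q d\<bar> * fact d * h ^ d \<le> 2 ^ d * M"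
  using assms
proof (induction d arbitrary: q M)
  case 0
  then obtain c where "q = [:c:]" by (auto elim: degree_eq_zeroE)
  thus ?case using 0(3)[of 0] by simp
next
  case (Suc d)
  obtain r where r: "\<forall>n\<ge>Suc d. coeff r n = 0" "coeff r d = of_nat (Suc d) * h * coeff q (Suc d)"
      "\<forall>t. poly r t = poly q (t + h) - poly q t"
    using forward_difference_poly[OF Suc.prems(1), of h] by auto
  have "\<bar>coeff r d\<bar> * fact d * h ^ d \<le> 2 ^ d * (2 * M)"
  proof (rule Suc.IH)
    show "degree r \<le> d" using r(1) by (intro degree_le) auto
    show "h \<ge> 0" by fact
    fix i assume "i \<le> d"
    thus "\<bar>poly r (a + of_nat i * h)\<bar> \<le> 2 * M"
      using Suc.prems(3)[of i] Suc.prems(3)[of "Suc i"] r(3)[rule_format, of "a + of_nat i * h"]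
      by (simp add: algebra_simps)
  qed
  moreover have "\<bar>coeff r d\<bar> = of_nat (Suc d) * h * \<bar>coeff q (Suc d)\<bar>"
    using Suc.prems(2) by (simp only: r(2) abs_mult abs_of_nat abs_of_nonneg)
  ultimately show ?case by (simp add: mult_ac del: of_nat_Suc)
qed

lemma power_self_le_exp_fact: "real d ^ d \<le> exp 1 ^ d * fact d"
proof -
  \<comment> \<open>The left side is a single term of the exponential series at \<open>d\<close>,
    all of whose terms are nonnegative.\<close>
  have "real d ^ d /\<^sub>R fact d \<le> exp (real d)"
    using sum_le_suminf[OF summable_exp_generic[of "real d"], of "{d}"] by (simp add: exp_def)
  moreover have "exp (real d) = exp 1 ^ d" by (simp add: exp_of_nat_mult[symmetric])
  ultimately show ?thesis by (simp add: field_simps)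
qed

lemma monic_bound_on_interval:
  fixes q :: "real poly"
  assumes "lead_coeff q = 1" "D \<ge> 0" "\<And>t. t \<in> {0..D} \<Longrightarrow> \<bar>poly q t\<bar> \<le> M"
  shows "D ^ degree q \<le> (2 * exp 1) ^ degree q * M"
proof (cases "degree q = 0")
  case False
  define d where "d = degree q"
  have d: "d > 0" using False by (simp add: d_def)
  have M: "M \<ge> 0" using assms(3)[of 0] assms(2) by auto
  have "\<bar>coeff q d\<bar> * fact d * (D / d) ^ d \<le> 2 ^ d * M"
  proof (rule lead_coeff_bound_equidistant[where a = 0])
    fix i assume "i \<le> d"
    hence "real i * D \<le> real d * D" using assms(2) by (intro mult_right_mono) auto
    thus "\<bar>poly q (0 + real i * (D / d))\<bar> \<le> M"
      using assms(2) d by (intro assms(3)) (auto simp: field_simps)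
  qed (use assms(2) in \<open>auto simp: d_def\<close>)
  hence "fact d * D ^ d \<le> 2 ^ d * M * real d ^ d"
    using assms(1) d by (simp add: d_def power_divide field_simps)
  also have "\<dots> \<le> 2 ^ d * M * (exp 1 ^ d * fact d)"
    using M by (intro mult_left_mono power_self_le_exp_fact) auto
  finally show ?thesis by (simp add: d_def power_mult_distrib mult_ac)
\<comment> \<open>In degree \<open>0\<close>, \<open>q\<close> is the constant \<open>1\<close> and
  the claim reads \<open>1 \<le> M\<close>.\<close>
qed (use assms in \<open>force dest!: degree0_coeffs\<close>)

section \<open>Projection to a line\<close>

lemma dist_le_of_bounded_on_connected:
  fixes x :: "'i \<Rightarrow> complex"
  assumes I: "finite I" and E: "connected E" "a \<in> E" "b \<in> E"
    and M: "\<And>z. z \<in> E \<Longrightarrow> cmod (\<Prod>j\<in>I. z - x j) \<le> M"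
  shows "cmod (a - b) ^ card I \<le> (2 * exp 1) ^ card I * M"
proof -
  \<comment> \<open>\<open>\<pi>\<close> is the coordinate along the line from \<open>a\<close> to
    \<open>b\<close>, with \<open>a\<close> at \<open>0\<close> and \<open>b\<close> at
    \<open>D\<close>. If \<open>a = b\<close>, then \<open>u\<close>, \<open>\<pi>\<close> and
    \<open>D\<close> all vanish.\<close>
  define u where "u = sgn (b - a)"
  define \<pi> where "\<pi> z = inner (z - a) u" for z
  define D where "D = cmod (b - a)"
  define q where "q = (\<Prod>j\<in>I. [:- \<pi> (x j), 1:])"
  have deg: "degree q = card I" by (simp add: q_def degree_prod_sum_eq)
  have \<pi>_b: "\<pi> b = D"
    by (cases "a = b")
       (simp_all add: \<pi>_def u_def D_def sgn_div_norm power2_norm_eq_inner[symmetric] power2_eq_square)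
  have contract: "\<bar>\<pi> z - \<pi> y\<bar> \<le> cmod (z - y)" for z y
  proof -
    have "\<pi> z - \<pi> y = inner (z - y) u" by (simp add: \<pi>_def inner_diff_left)
    also have "\<bar>\<dots>\<bar> \<le> cmod (z - y) * cmod u" by (rule Cauchy_Schwarz_ineq2)
    also have "\<dots> \<le> cmod (z - y) * 1" by (intro mult_left_mono) (auto simp: u_def norm_sgn)
    finally show ?thesis by simp
  qed
  have "connected (\<pi> ` E)"
    unfolding \<pi>_def by (intro connected_continuous_image E continuous_intros)
  moreover have "0 \<in> \<pi> ` E" using E by (force simp: \<pi>_def)
  moreover have "D \<in> \<pi> ` E" using E \<pi>_b by force
  ultimately have sub: "{0..D} \<subseteq> \<pi> ` E" by (rule connected_contains_Icc)
  have "D ^ degree q \<le> (2 * exp 1) ^ degree q * M"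
  proof (rule monic_bound_on_interval)
    show "lead_coeff q = 1" by (simp add: q_def lead_coeff_prod)
    show "D \<ge> 0" by (simp add: D_def)
    fix t assume "t \<in> {0..D}"
    then obtain z where z: "z \<in> E" "t = \<pi> z" using sub by blast
    have "\<bar>poly q t\<bar> = (\<Prod>j\<in>I. \<bar>\<pi> z - \<pi> (x j)\<bar>)"
      by (simp add: q_def poly_prod abs_prod z)
    also have "\<dots> \<le> (\<Prod>j\<in>I. cmod (z - x j))"
      \<comment> \<open>The projection is 1-Lipschitz, so no factor grows.\<close>
      by (intro prod_mono) (use contract in auto)
    also have "\<dots> \<le> M" using M[OF z(1)] by (simp add: prod_norm)
    finally show "\<bar>poly q t\<bar> \<le> M" .
  qed
  thus ?thesis by (simp add: deg D_def norm_minus_commute)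
qed

theorem theorem6:
  fixes n :: nat and x :: "nat \<Rightarrow> complex" and p :: "complex poly"
  assumes "p = (\<Prod>j = 0..n. [:- x j, 1:])"
    and "critical_values p \<subseteq> cball 0 1"
  shows "diameter {z. poly p z = 0} \<le> 4 * exp 1 \<and>
    (\<forall>j\<in>{0..n}. \<forall>k\<in>{0..n}. cmod (x j - x k) \<le> 4 * exp 1)"
proof -
  have deg: "degree p = Suc n" by (simp add: assms(1) degree_prod_sum_eq)
  have poly_p: "poly p z = (\<Prod>j\<in>{0..n}. z - x j)" for z
    by (simp add: assms(1) poly_prod)
  have dist_roots: "cmod (a - b) \<le> 4 * exp 1" if "poly p a = 0" "poly p b = 0" for a b
  proof -
    have "connected {z. cmod (poly p z) \<le> 2}"
      by (rule connected_lemniscate[OF _ assms(2)]) (auto simp: deg)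
    hence "cmod (a - b) ^ card {0..n} \<le> (2 * exp 1) ^ card {0..n} * 2"
      using that
      by (intro dist_le_of_bounded_on_connected[where E = "{z. cmod (poly p z) \<le> 2}" and x = x])
         (simp_all flip: poly_p)
    \<comment> \<open>The level \<open>2\<close> of the lemniscate is absorbed into the power, as
      the degree is at least \<open>1\<close>; the \<open>card {0..n}\<close>-th root then gives
      \<open>4 * exp 1\<close>.\<close>
    also have "\<dots> \<le> (2 * exp 1) ^ card {0..n} * 2 ^ card {0..n}"
      by (intro mult_left_mono) auto
    also have "\<dots> = (2 * exp 1 * 2) ^ card {0..n}"
      by (rule power_mult_distrib[symmetric])
    finally have "cmod (a - b) \<le> 2 * exp 1 * 2"
      by (subst (asm) power_mono_iff) auto
    thus ?thesis by simp
  qed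
  have "diameter {z. poly p z = 0} \<le> 4 * exp 1"
    by (rule diameter_le) (use dist_roots in auto)
  moreover have "poly p (x j) = 0" if "j \<in> {0..n}" for j
    using that by (auto simp: poly_p)
  ultimately show ?thesis using dist_roots by blast
qed

end
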